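(* Let $n>0$ and let $C\subset S$ be a generic rational curve of degree $n$ in the Study quadric, passing through $1$. Then $C$ can be obtained as the movement of the last link of an open $k$R-linkage with $k\le n$, such that the rotations in the $k$ joints have a simultaneous rational parametrization and the sum of the degrees of these parametrizations equals $n$. That is, there exist $k\le n$, rotation quaternions $g_1,\dots,g_k\in\mathbb{D}\mathbb{H}$, positive integers $m_1,\dots,m_k$ with $m_1+\dots+m_k=n$, and for each $j$ a rational parametrization $R_{1,j}(t)-g_jR_{2,j}(t)$ of degree $m_j$ of the rotation group of $g_j$, such that $C$ is parametrized by $$t\in\mathbb{P}^1\longmapsto\bigl(R_{1,1}(t)-g_1R_{2,1}(t)\bigr)\cdots\bigl(R_{1,k}(t)-g_kR_{2,k}(t)\bigr).$$
   Context: Dual quaternions. Let $\mathbb{D}=\mathbb{R}+\epsilon\mathbb{R}$ with $\epsilon^2=0$ be the dual numbers, $\mathbb{H}$ the real quaternions, and $\mathbb{D}\mathbb{H}$ the algebra of quaternions with coefficients in $\mathbb{D}$ ($\epsilon$ central). Write $h=p+\epsilon q$ with $p,q\in\mathbb{H}$; $p$ is the primal part. The conjugate $\overline{h}$ is obtained by multiplying the vectorial part of $h$ by $-1$. Let $\mathbb{P}^7$ be the projectivization of $\mathbb{D}\mathbb{H}$ as a real 8-dimensional vector space; the Study quadric $S\subset\mathbb{P}^7$ is the set of classes of $h$ with $h\overline{h}\in\mathbb{R}$, and $E\subset S$ is the 3-space of classes with zero primal part. The group $S\setminus E$ (under multiplication) is isomorphic to the group $\mathrm{SE}_3$ of direct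 Euclidean displacements. A nonzero $h=p+\epsilon q$ is a rotation quaternion if $h\overline{h}\in\mathbb{R}$, $h+\overline{h}\in\mathbb{R}$ and $p\notin\mathbb{R}$; the rotation group defined by $h$ is $\{[t-h]:t\in\mathbb{P}^1\}$, with $\mathbb{P}^1=\mathbb{R}\cup\{\infty\}$ and the value at $\infty$ being the class of $1$. Curves. $\mathbb{D}\mathbb{H}[t]$ is the polynomial ring in which $t$ commutes with the coefficients; for $P=\sum a_it^i$ put $\overline{P}=\sum\overline{a_i}t^i$. A motion polynomial is a monic $P\in\mathbb{D}\mathbb{H}[t]$ with $P\overline{P}\in\mathbb{R}[t]$; it is generic, if of degree $n>0$, when $P\overline{P}$ is a product of $n$ pairwise distinct monic quadratic polynomials in $\mathbb{R}[t]$ that are irreducible over $\mathbb{R}$. For monic $P$, the associated map $\mathbb{P}^1\to\mathbb{P}^7$ is $t\mapsto[P(t)]$, with $\infty\mapsto[1]$. A rational curve $C\subset S$ of degree $n$ passing through $1$ admits a parametrization by a motion polynomial $P$ of degree $n$, i.e. $C$ is the image of the map associated to $P$; $C$ is called generic if $P$ is generic. Linkages. An open $k$R-linkage is a chain of $k+1$ links, consecutive ones connected by a rotational joint whose relative motions form the rotation group of a rotation quaternion $g_j$; the position of the last link with respect to the first is the product of the $k$ rotations. A rational parametrization of degree $m$ of the rotation group of a rotation quaternion $g$ is $(R_1(t)-gR_2(t))_{t\in\mathbb{P}^1}$ with $R_1,R_2\in\mathbb{R}[t]$, $R_1$ monic, $\deg R_1=m$, $\deg R_2<m$, and $R_1,R_2$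 without common factor. "Simultaneous" means that the same parameter $t$ is used in all joints. *)

theory Defs
  imports Complex_Main "HOL-Computational_Algebra.Computational_Algebra"
begin

section \<open>Real quaternions\<close>

codatatype quat = Quat (qre: real) (qi: real) (qj: real) (qk: real)

lemma quat_eq_iff: "x = y \<longleftrightarrow> qre x = qre y \<and> qi x = qi y \<and> qj x = qj y \<and> qk x = qk y"
  by (auto intro: quat.expand)

instantiation quat :: real_algebra_1
begin

primcorec zero_quat where
  "qre 0 = 0" | "qi 0 = 0" | "qj 0 = 0" | "qk 0 = 0"

primcorec one_quat where
  "qre 1 = 1" | "qi 1 = 0" | "qj 1 = 0" | "qk 1 = 0"

primcorec plus_quat where
  "qre (x + y) = qre x + qre y"
| "qi (x + y) = qi x + qi y"
| "qj (x + y) = qj x + qj y"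
| "qk (x + y) = qk x + qk y"

primcorec uminus_quat where
  "qre (- x) = - qre x" | "qi (- x) = - qi x" | "qj (- x) = - qj x" | "qk (- x) = - qk x"

primcorec minus_quat where
  "qre (x - y) = qre x - qre y"
| "qi (x - y) = qi x - qi y"
| "qj (x - y) = qj x - qj y"
| "qk (x - y) = qk x - qk y"

primcorec times_quat where
  "qre (x * y) = qre x * qre y - qi x * qi y - qj x * qj y - qk x * qk y"
| "qi (x * y) = qre x * qi y + qi x * qre y + qj x * qk y - qk x * qj y"
| "qj (x * y) = qre x * qj y - qi x * qk y + qj x * qre y + qk x * qi y"
| "qk (x * y) = qre x * qk y + qi x * qj y - qj x * qi y + qk x * qre y"

primcorec scaleR_quat where
  "qre (r *\<^sub>R x) = r * qre x"
| "qi (r *\<^sub>R x) = r * qi x"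
| "qj (r *\<^sub>R x) = r * qj x"
| "qk (r *\<^sub>R x) = r * qk x"

instance
  by intro_classes (simp_all add: quat_eq_iff algebra_simps)

end

primcorec qcnj :: "quat \<Rightarrow> quat" where
  "qre (qcnj x) = qre x"
| "qi (qcnj x) = - qi x"
| "qj (qcnj x) = - qj x"
| "qk (qcnj x) = - qk x"


section \<open>Dual quaternions\<close>

text \<open>\<open>DQuat p q\<close> is \<open>p + \<epsilon> q\<close>, where \<open>\<epsilon>\<close> is central and \<open>\<epsilon>\<^sup>2 = 0\<close>.\<close>

codatatype dquat = DQuat (primal: quat) (dualpart: quat)

lemma dquat_eq_iff: "x = y \<longleftrightarrow> primal x = primal y \<and> dualpart x = dualpart y"
  by (auto intro: dquat.expand)

instantiation dquat :: real_algebra_1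
begin

primcorec zero_dquat where
  "primal 0 = 0" | "dualpart 0 = 0"

primcorec one_dquat where
  "primal 1 = 1" | "dualpart 1 = 0"

primcorec plus_dquat where
  "primal (x + y) = primal x + primal y"
| "dualpart (x + y) = dualpart x + dualpart y"

primcorec uminus_dquat where
  "primal (- x) = - primal x" | "dualpart (- x) = - dualpart x"

primcorec minus_dquat where
  "primal (x - y) = primal x - primal y"
| "dualpart (x - y) = dualpart x - dualpart y"

primcorec times_dquat where
  "primal (x * y) = primal x * primal y"
| "dualpart (x * y) = primal x * dualpart y + dualpart x * primal y"

primcorec scaleR_dquat where
  "primal (r *\<^sub>R x) = r *\<^sub>R primal x"
| "dualpart (r *\<^sub>R x) = r *\<^sub>R dualpart x"

instance
  by intro_classes (simp_all add: dquat_eq_iff algebra_simps)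

end

primcorec dqcnj :: "dquat \<Rightarrow> dquat" where
  "primal (dqcnj x) = qcnj (primal x)"
| "dualpart (dqcnj x) = qcnj (dualpart x)"


section \<open>Projective space and the Study quadric\<close>

text \<open>
  A point of the projective space \<open>P\<^sup>7\<close> is a one-dimensional real subspace of \<^typ>\<open>dquat\<close>;
  \<open>proj h\<close> is such a point only if \<open>h \<noteq> 0\<close>.
\<close>

type_synonym point = "dquat set"

definition proj :: "dquat \<Rightarrow> point" where
  "proj h = span {h}"

definition study_quadric :: "point set" where
  "study_quadric = {proj h |h. h \<noteq> 0 \<and> h * dqcnj h \<in> \<real>}"

text \<open>The parameter line \<open>P\<^sup>1\<close>, i.e. the reals together with a point at infinity.\<close>

datatype rp1 = Fin real | Infty


section \<open>Polynomials over the dual quaternions and motion polynomials\<close>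

text \<open>
  The multiplication of the type \<open>'a poly\<close> is restricted to commutative coefficients, so
  the product and the evaluation at real points are defined here. The indeterminate commutes
  with the coefficients. A real polynomial \<open>r\<close> is embedded as \<open>map_poly of_real r\<close>.
\<close>

definition dq_poly_mult :: "dquat poly \<Rightarrow> dquat poly \<Rightarrow> dquat poly" where
  "dq_poly_mult P Q = (\<Sum>i\<le>degree P. \<Sum>j\<le>degree Q. monom (coeff P i * coeff Q j) (i + j))"

definition dq_poly_eval :: "dquat poly \<Rightarrow> real \<Rightarrow> dquat" where
  "dq_poly_eval P t = (\<Sum>i\<le>degree P. t ^ i *\<^sub>R coeff P i)"

definition dq_poly_cnj :: "dquat poly \<Rightarrow> dquat poly" where
  "dq_poly_cnj P = map_poly dqcnj P"

lemma coeff_dq_poly_mult: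
  "coeff (dq_poly_mult P Q) n = (\<Sum>i\<le>n. coeff P i * coeff Q (n - i))"
proof -
  have inner: "(\<Sum>j\<le>degree Q. coeff (monom (coeff P i * coeff Q j) (i + j)) n) =
        (if i \<le> n then coeff P i * coeff Q (n - i) else 0)" for i
  proof -
    have "(\<Sum>j\<le>degree Q. coeff (monom (coeff P i * coeff Q j) (i + j)) n) =
          (\<Sum>j\<le>degree Q. if j = n - i then (if i \<le> n then coeff P i * coeff Q j else 0) else 0)"
      by (rule sum.cong) auto
    also have "\<dots> = (if i \<le> n then coeff P i * coeff Q (n - i) else 0)"
      by (auto simp: sum.delta coeff_eq_0)
    finally show ?thesis .
  qed
  have "coeff (dq_poly_mult P Q) n =
        (\<Sum>i\<le>degree P. if i \<le> n then coeff P i * coeff Q (n - i) else 0)"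
    by (simp add: dq_poly_mult_def coeff_sum inner del: coeff_monom)
  also have "\<dots> = (\<Sum>i\<in>{..degree P} \<inter> {..n}. coeff P i * coeff Q (n - i))"
    by (subst sum.inter_restrict) (simp_all only: finite_atMost atMost_iff)
  also have "\<dots> = (\<Sum>i\<le>n. coeff P i * coeff Q (n - i))"
    by (rule sum.mono_neutral_left) (auto intro!: le_degree)
  finally show ?thesis .
qed

definition motion_polynomial :: "dquat poly \<Rightarrow> bool" where
  "motion_polynomial P \<longleftrightarrow>
     lead_coeff P = 1 \<and> (\<exists>r::real poly. dq_poly_mult P (dq_poly_cnj P) = map_poly of_real r)"

definition generic_motion_polynomial :: "dquat poly \<Rightarrow> bool" where
  "generic_motion_polynomial P \<longleftrightarrow> motion_polynomial P \<and> degree P > 0 \<and>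
     (\<exists>M::real poly set. finite M \<and> card M = degree P \<and>
        (\<forall>q\<in>M. lead_coeff q = 1 \<and> degree q = 2 \<and> irreducible q) \<and>
        dq_poly_mult P (dq_poly_cnj P) = map_poly of_real (\<Prod>q\<in>M. q))"

definition assoc_map :: "dquat poly \<Rightarrow> rp1 \<Rightarrow> point" where
  "assoc_map P \<tau> = (case \<tau> of Fin t \<Rightarrow> proj (dq_poly_eval P t) | Infty \<Rightarrow> proj 1)"

definition generic_rational_curve :: "nat \<Rightarrow> point set \<Rightarrow> bool" where
  "generic_rational_curve n C \<longleftrightarrow> C \<subseteq> study_quadric \<and> proj 1 \<in> C \<and>
     (\<exists>P. generic_motion_polynomial P \<and> degree P = n \<and> C = range (assoc_map P))"


section \<open>Rotations and linkages\<close>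

definition rotation_quaternion :: "dquat \<Rightarrow> bool" where
  "rotation_quaternion h \<longleftrightarrow>
     h \<noteq> 0 \<and> h * dqcnj h \<in> \<real> \<and> h + dqcnj h \<in> \<real> \<and> primal h \<notin> \<real>"

definition rotation :: "dquat \<Rightarrow> rp1 \<Rightarrow> point" where
  "rotation h \<tau> = (case \<tau> of Fin t \<Rightarrow> proj (of_real t - h) | Infty \<Rightarrow> proj 1)"

definition rotation_group :: "dquat \<Rightarrow> point set" where
  "rotation_group h = range (rotation h)"

text \<open>
  The pair \<open>(R\<^sub>1, R\<^sub>2)\<close> encodes the parametrization \<open>R\<^sub>1(t) - g R\<^sub>2(t)\<close>. Since
  \<open>R\<^sub>1\<close> is monic and \<open>deg R\<^sub>2 < deg R\<^sub>1\<close>, its class at infinity is that of \<open>1\<close>.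
\<close>

definition rotation_parametrization :: "nat \<Rightarrow> real poly \<Rightarrow> real poly \<Rightarrow> bool" where
  "rotation_parametrization m R1 R2 \<longleftrightarrow>
     lead_coeff R1 = 1 \<and> degree R1 = m \<and> degree R2 < m \<and> coprime R1 R2"

definition joint_value :: "dquat \<Rightarrow> real poly \<Rightarrow> real poly \<Rightarrow> rp1 \<Rightarrow> dquat" where
  "joint_value g R1 R2 \<tau> =
     (case \<tau> of Fin t \<Rightarrow> of_real (poly R1 t) - g * of_real (poly R2 t) | Infty \<Rightarrow> 1)"

lemma proj_scaleR: "c \<noteq> 0 \<Longrightarrow> proj (c *\<^sub>R h) = proj h"
  unfolding proj_def span_singleton
  by (auto simp: image_iff) (metis divide_self_if scaleR_one times_divide_eq_left
      times_divide_eq_right mult.right_neutral)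

lemma joint_value_in_rotation_group:
  assumes "rotation_parametrization m R1 R2"
  shows "proj (joint_value g R1 R2 \<tau>) \<in> rotation_group g"
proof (cases \<tau>)
  case Infty
  then show ?thesis
    by (auto simp: joint_value_def rotation_group_def rotation_def image_iff intro!: exI[of _ Infty])
next
  case (Fin t)
  show ?thesis
  proof (cases "poly R2 t = 0")
    case True
    have "poly R1 t \<noteq> 0"
      using assms True coprime_poly_0 [of R1 R2 t] by (auto simp: rotation_parametrization_def)
    then have "proj (joint_value g R1 R2 \<tau>) = rotation g Infty"
      using proj_scaleR[of "poly R1 t" 1] True Fin
      by (simp add: joint_value_def rotation_def of_real_def)
    then show ?thesis
      by (simp add: rotation_group_def)
  next
    case False
    have "joint_value g R1 R2 \<tau> =
          poly R2 t *\<^sub>R (of_real (poly R1 t / poly R2 t) - g)"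
      using False Fin by (simp add: joint_value_def scaleR_right_diff_distrib of_real_def)
    then have "proj (joint_value g R1 R2 \<tau>) = rotation g (Fin (poly R1 t / poly R2 t))"
      using proj_scaleR False by (simp add: rotation_def)
    then show ?thesis
      by (simp add: rotation_group_def)
  qed
qed

text \<open>
  Position of the last link, relative to the first, of the open linkage with \<open>k\<close> rotational
  joints whose \<open>j\<close>-th joint is moved by \<open>R\<^sub>1 j - g j R\<^sub>2 j\<close>, all joints at the same parameter value.
\<close>

definition last_link_position ::
  "nat \<Rightarrow> (nat \<Rightarrow> dquat) \<Rightarrow> (nat \<Rightarrow> real poly) \<Rightarrow> (nat \<Rightarrow> real poly) \<Rightarrow> rp1 \<Rightarrow> point" where
  "last_link_position k g R1 R2 \<tau> =
     proj (prod_list (map (\<lambda>j. joint_value (g j) (R1 j) (R2 j) \<tau>) [1..<Suc k]))"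

end

theory Submission
  imports Defs
begin

text \<open>
  A generic motion polynomial \<open>P\<close> of degree \<open>n\<close> is a product of \<open>n\<close> linear factors \<open>t - h\<^sub>j\<close> with
  rotation quaternions \<open>h\<^sub>j\<close>. So \<open>k = n\<close> joints suffice, all with \<open>R\<^sub>1 = t\<close> and \<open>R\<^sub>2 = 1\<close>.

  The factorization (lemma \<open>generic_factorization\<close>) splits off one right factor for each quadratic
  factor \<open>q\<close> of the norm polynomial \<open>P \<cdot> cnj P\<close>. Division with remainder by the real, hence
  central, polynomial \<open>q\<close> gives \<open>P = q Q + R\<close> with \<open>R = r\<^sub>1 t + r\<^sub>0\<close>. The polynomial \<open>R \<cdot> cnj R\<close> is
  divisible by \<open>q\<close> and has degree at most two, so it is \<open>q\<close> times its leading coefficient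
  \<open>r\<^sub>1 \<cdot> cnj r\<^sub>1\<close>. If \<open>r\<^sub>1\<close> had primal part zero, then the primal part of \<open>R\<close> would have norm zero and
  so would vanish; hence \<open>q\<close> would divide the primal part of \<open>P\<close>, and \<open>q\<^sup>2\<close> would divide the norm
  polynomial, which is squarefree. Therefore \<open>r\<^sub>1\<close> is invertible, \<open>R = r\<^sub>1 (t - h)\<close>, and cancelling
  \<open>r\<^sub>1\<close> yields \<open>(t - h)(t - cnj h) = q\<close>. This makes \<open>h\<close> a rotation quaternion and gives
  \<open>P = (Q (t - cnj h) + r\<^sub>1)(t - h)\<close>. The left factor is monic, and its norm polynomial is the
  product of the remaining quadratic factors.

  Since the indeterminate is central, evaluation at a real number is multiplicative, and a
  polynomial over the dual quaternions is determined by its values at the real numbers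
  (lemma \<open>dq_poly_eqI\<close>). The polynomial identities above are therefore checked pointwise.
\<close>

section \<open>Conjugation and inverses\<close>

lemma dquat_components_eq_iff:
  "x = y \<longleftrightarrow>
     qre (primal x) = qre (primal y) \<and> qi (primal x) = qi (primal y) \<and>
     qj (primal x) = qj (primal y) \<and> qk (primal x) = qk (primal y) \<and>
     qre (dualpart x) = qre (dualpart y) \<and> qi (dualpart x) = qi (dualpart y) \<and>
     qj (dualpart x) = qj (dualpart y) \<and> qk (dualpart x) = qk (dualpart y)"
  by (simp add: dquat_eq_iff quat_eq_iff conj_assoc)

lemma dqcnj_0 [simp]: "dqcnj 0 = 0"
  by (simp add: dquat_components_eq_iff)

lemma dqcnj_add: "dqcnj (x + y) = dqcnj x + dqcnj y"
  by (simp add: dquat_components_eq_iff)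

lemma dqcnj_diff: "dqcnj (x - y) = dqcnj x - dqcnj y"
  by (simp add: dquat_components_eq_iff)

lemma dqcnj_scaleR: "dqcnj (r *\<^sub>R x) = r *\<^sub>R dqcnj x"
  by (simp add: dquat_components_eq_iff)

lemma dqcnj_of_real [simp]: "dqcnj (of_real r) = of_real r"
  by (simp add: dquat_components_eq_iff of_real_def)

lemma dqcnj_1 [simp]: "dqcnj 1 = 1"
  by (simp add: dquat_components_eq_iff)

lemma dqcnj_mult: "dqcnj (x * y) = dqcnj y * dqcnj x"
  by (simp add: dquat_components_eq_iff algebra_simps)

lemma primal_of_real [simp]: "primal (of_real r) = of_real r"
  by (simp add: of_real_def)

lemma qre_of_real [simp]: "qre (of_real r) = r"
  by (simp add: of_real_def)

lemma primal_eq_0_if_norm_eq_0: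
  assumes "primal (x * dqcnj x) = 0"
  shows "primal x = 0"
proof -
  let ?p = "primal x"
  have "(qre ?p)\<^sup>2 + (qi ?p)\<^sup>2 + (qj ?p)\<^sup>2 + (qk ?p)\<^sup>2 = 0"
    using assms by (simp add: quat_eq_iff power2_eq_square)
  then have "qre ?p = 0 \<and> qi ?p = 0 \<and> qj ?p = 0 \<and> qk ?p = 0"
    by (simp add: add_nonneg_eq_0_iff)
  then show ?thesis
    by (simp add: quat_eq_iff)
qed

lemma quat_inverse_exists:
  fixes p :: quat
  assumes "p \<noteq> 0"
  shows "\<exists>u. u * p = 1 \<and> p * u = 1"
proof -
  define N where "N = (qre p)\<^sup>2 + (qi p)\<^sup>2 + (qj p)\<^sup>2 + (qk p)\<^sup>2"
  have "N \<noteq> 0"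
    using assms by (auto simp: N_def quat_eq_iff add_nonneg_eq_0_iff)
  have "qcnj p * p = N *\<^sub>R 1" "p * qcnj p = N *\<^sub>R 1"
    by (simp_all add: quat_eq_iff N_def power2_eq_square algebra_simps)
  then have "(inverse N *\<^sub>R qcnj p) * p = 1 \<and> p * (inverse N *\<^sub>R qcnj p) = 1"
    using \<open>N \<noteq> 0\<close> by simp
  then show ?thesis by blast
qed

lemma dquat_inverse_exists:
  assumes "primal x \<noteq> 0"
  shows "\<exists>u. u * x = 1 \<and> x * u = 1"
proof -
  obtain v where v: "v * primal x = 1" "primal x * v = 1"
    using quat_inverse_exists assms by blast
  \<comment> \<open>the first-order expansion of the inverse of \<open>p + \<epsilon> s\<close> is \<open>v - \<epsilon> v s v\<close>, where \<open>v\<close> inverts \<open>p\<close>\<close>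
  let ?u = "DQuat v (- (v * dualpart x * v))"
  have "?u * x = 1" "x * ?u = 1"
    using v by (simp_all add: dquat_eq_iff mult.assoc flip: mult.assoc[of "primal x" v])
  then show ?thesis by blast
qed

section \<open>Evaluation of polynomials over the dual quaternions\<close>

lemma dq_poly_eval_bound:
  assumes "degree P \<le> n"
  shows "dq_poly_eval P t = (\<Sum>i\<le>n. t ^ i *\<^sub>R coeff P i)"
  unfolding dq_poly_eval_def using assms
  by (intro sum.mono_neutral_left) (auto simp: coeff_eq_0)

lemma dq_poly_eval_0 [simp]: "dq_poly_eval 0 t = 0"
  by (simp add: dq_poly_eval_def)

lemma dq_poly_eval_add [simp]: "dq_poly_eval (P + Q) t = dq_poly_eval P t + dq_poly_eval Q t"
proof -
  let ?n = "max (degree P) (degree Q)"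
  have "degree (P + Q) \<le> ?n"
    by (rule degree_add_le_max)
  then show ?thesis
    by (simp add: dq_poly_eval_bound[of _ ?n] scaleR_add_right sum.distrib)
qed

lemma dq_poly_eval_diff [simp]: "dq_poly_eval (P - Q) t = dq_poly_eval P t - dq_poly_eval Q t"
  using dq_poly_eval_add[of "P - Q" Q t] by simp

lemma dq_poly_eval_pCons [simp]: "dq_poly_eval (pCons a P) t = a + t *\<^sub>R dq_poly_eval P t"
proof -
  have "dq_poly_eval (pCons a P) t = (\<Sum>i\<le>Suc (degree P). t ^ i *\<^sub>R coeff (pCons a P) i)"
    by (rule dq_poly_eval_bound) (rule degree_pCons_le)
  also have "\<dots> = a + t *\<^sub>R dq_poly_eval P t"
    by (simp add: sum.atMost_Suc_shift dq_poly_eval_def scaleR_sum_right del: sum.atMost_Suc)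
  finally show ?thesis .
qed

lemma dq_poly_eval_monom [simp]: "dq_poly_eval (monom a n) t = t ^ n *\<^sub>R a"
  by (induction n) (simp_all add: monom_0 monom_Suc)

lemma dq_poly_eval_sum: "dq_poly_eval (sum f A) t = (\<Sum>x\<in>A. dq_poly_eval (f x) t)"
  by (induction A rule: infinite_finite_induct) simp_all

lemma dq_poly_eval_mult [simp]:
  "dq_poly_eval (dq_poly_mult P Q) t = dq_poly_eval P t * dq_poly_eval Q t"
  unfolding dq_poly_mult_def dq_poly_eval_sum dq_poly_eval_monom
  by (simp add: dq_poly_eval_def sum_product power_add mult.commute)

lemma dq_poly_eval_cnj [simp]: "dq_poly_eval (dq_poly_cnj P) t = dqcnj (dq_poly_eval P t)"
  unfolding dq_poly_cnj_def
  by (induction P) (simp_all add: map_poly_pCons dqcnj_add dqcnj_scaleR)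

lemma dq_poly_eval_of_real [simp]:
  "dq_poly_eval (map_poly of_real r) t = of_real (poly r t)"
  by (induction r) (simp_all add: map_poly_pCons of_real_def scaleR_add_left)

text \<open>
  Applying a real linear functional, for example a coordinate, to all coefficients yields a real
  polynomial whose values are those of the functional on the values.
\<close>

lemma poly_map_poly_linear:
  fixes f :: "dquat \<Rightarrow> real"
  assumes "\<And>x y. f (x + y) = f x + f y" "\<And>r x. f (r *\<^sub>R x) = r * f x"
  shows "poly (map_poly f P) t = f (dq_poly_eval P t)"
proof -
  have "f 0 = 0"
    using assms(2)[of 0 0] by simp
  then show ?thesis
    by (induction P) (simp_all add: map_poly_pCons assms)
qed

lemma dq_poly_eqI:
  assumes "\<And>t. dq_poly_eval P t = dq_poly_eval Q t"
  shows "P = Q"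
proof -
  have coeff_eq: "f (coeff P i) = f (coeff Q i)"
    if f: "\<And>x y. f (x + y) = f x + f y" "\<And>r x. f (r *\<^sub>R x) = r * f x"
    for f :: "dquat \<Rightarrow> real" and i
  proof -
    have "poly (map_poly f P) = poly (map_poly f Q)"
      using assms by (simp add: fun_eq_iff poly_map_poly_linear f)
    then have "map_poly f P = map_poly f Q"
      by (simp add: poly_eq_poly_eq_iff)
    moreover have "f 0 = 0"
      using f(2)[of 0 0] by simp
    ultimately show ?thesis
      by (metis coeff_map_poly)
  qed
  show ?thesis
  proof (rule poly_eqI)
    fix i
    show "coeff P i = coeff Q i"
      using coeff_eq[of "\<lambda>x. qre (primal x)" i] coeff_eq[of "\<lambda>x. qi (primal x)" i]
        coeff_eq[of "\<lambda>x. qj (primal x)" i] coeff_eq[of "\<lambda>x. qk (primal x)" i]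
        coeff_eq[of "\<lambda>x. qre (dualpart x)" i] coeff_eq[of "\<lambda>x. qi (dualpart x)" i]
        coeff_eq[of "\<lambda>x. qj (dualpart x)" i] coeff_eq[of "\<lambda>x. qk (dualpart x)" i]
      by (simp add: dquat_components_eq_iff)
  qed
qed

section \<open>Division by a monic real quadratic polynomial\<close>

text \<open>
  Only the shape of the remainder matters, so no bound on the degree of \<open>Q\<close> is recorded.
\<close>

lemma dq_poly_division:
  "\<exists>Q r1 r0. \<forall>t. dq_poly_eval P t =
     (t\<^sup>2 + m1 * t + m0) *\<^sub>R dq_poly_eval Q t + (t *\<^sub>R r1 + r0)"
proof (induction P)
  case 0
  show ?case
    by (intro exI[of _ 0]) simp
next
  case (pCons a P)
  then obtain Q r1 r0 where IH:
    "\<And>t. dq_poly_eval P t = (t\<^sup>2 + m1 * t + m0) *\<^sub>R dq_poly_eval Q t + (t *\<^sub>R r1 + r0)"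
    by blast
  \<comment> \<open>multiply by \<open>t\<close> and reduce \<open>t\<^sup>2\<close> in the remainder by \<open>- m1 t - m0\<close>\<close>
  have "dq_poly_eval (pCons a P) t =
      (t\<^sup>2 + m1 * t + m0) *\<^sub>R dq_poly_eval (pCons r1 Q) t +
      (t *\<^sub>R (r0 - m1 *\<^sub>R r1) + (a - m0 *\<^sub>R r1))" for t
    by (simp add: IH algebra_simps power2_eq_square)
  then show ?case by blast
qed

lemma coeff_mult_quadratic:
  "coeff (dq_poly_mult [:a, b, 1:] S) (Suc (Suc d)) =
     coeff S d + b * coeff S (Suc d) + a * coeff S (Suc (Suc d))"
proof -
  have "coeff (dq_poly_mult [:a, b, 1:] S) (Suc (Suc d)) =
      (\<Sum>i\<in>{0, 1, 2}. coeff [:a, b, 1:] i * coeff S (Suc (Suc d) - i))"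
    unfolding coeff_dq_poly_mult
    by (rule sum.mono_neutral_right) (auto simp: coeff_pCons split: nat.split)
  then show ?thesis
    by (simp add: numeral_2_eq_2 algebra_simps)
qed

text \<open>
  A polynomial of degree at most two that is a multiple of a monic quadratic one is a constant
  multiple of it, the constant being the coefficient of \<open>t\<^sup>2\<close>.
\<close>

lemma quadratic_multiple_of_quadratic:
  assumes eq: "\<And>t. t\<^sup>2 *\<^sub>R c2 + t *\<^sub>R c1 + c0 = (t\<^sup>2 + m1 * t + m0) *\<^sub>R dq_poly_eval S t"
  shows "t\<^sup>2 *\<^sub>R c2 + t *\<^sub>R c1 + c0 = (t\<^sup>2 + m1 * t + m0) *\<^sub>R c2"
proof -
  have A: "[:c0, c1, c2:] = dq_poly_mult [:of_real m0, of_real m1, 1:] S"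
    using eq by (intro dq_poly_eqI)
      (simp add: algebra_simps power2_eq_square of_real_def)
  have "degree S = 0"
  proof (rule ccontr)
    assume "degree S \<noteq> 0"
    then obtain d where d: "degree S = Suc d"
      using not0_implies_Suc by blast
    have "coeff [:c0, c1, c2:] (Suc (Suc (Suc d))) = coeff S (Suc d)"
      unfolding A coeff_mult_quadratic using d by (simp add: coeff_eq_0)
    then show False
      using d leading_coeff_0_iff[of S] by (simp add: coeff_pCons)
  qed
  then obtain s where S: "S = [:s:]"
    by (rule degree_eq_zeroE)
  have "coeff [:c0, c1, c2:] (Suc (Suc 0)) = s"
    unfolding A coeff_mult_quadratic using S by (simp add: coeff_pCons)
  then have "s = c2"
    by (simp add: coeff_pCons)
  then show ?thesis
    using eq S by simp
qed

section \<open>Splitting off a linear factor\<close>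

text \<open>
  The norm of a linear polynomial \<open>r\<^sub>1 t + r\<^sub>0\<close> with \<open>r\<^sub>1\<close> invertible determines the norm of
  its monic associate \<open>t - h\<close>.
\<close>

lemma linear_remainder_root:
  assumes r1: "primal r1 \<noteq> 0"
    and norm: "\<And>t. (t *\<^sub>R r1 + r0) * dqcnj (t *\<^sub>R r1 + r0) =
                    (t\<^sup>2 + m1 * t + m0) *\<^sub>R (r1 * dqcnj r1)"
  obtains h where
    "\<And>t. t *\<^sub>R r1 + r0 = r1 * (of_real t - h)"
    "\<And>t. (of_real t - h) * (of_real t - dqcnj h) = of_real (t\<^sup>2 + m1 * t + m0)"
    "\<And>t. (of_real t - dqcnj h) * (of_real t - h) = of_real (t\<^sup>2 + m1 * t + m0)"
    "h * dqcnj h = of_real m0" "h + dqcnj h = of_real (- m1)"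
proof -
  obtain u where u: "u * r1 = 1" "r1 * u = 1"
    using dquat_inverse_exists r1 by blast
  define h where "h = - (u * r0)"
  have r0: "r0 = - (r1 * h)"
    using u by (simp add: h_def flip: mult.assoc)
  have factor: "t *\<^sub>R r1 + r0 = r1 * (of_real t - h)" for t
    by (simp add: r0 algebra_simps of_real_def)
  have cnj_u: "dqcnj r1 * dqcnj u = 1"
    using u by (simp flip: dqcnj_mult)
  have right: "(of_real t - h) * (of_real t - dqcnj h) = of_real (t\<^sup>2 + m1 * t + m0)" for t
  proof -
    let ?x = "(of_real t - h) * (of_real t - dqcnj h)"
    have "r1 * ?x * dqcnj r1 = (t\<^sup>2 + m1 * t + m0) *\<^sub>R (r1 * dqcnj r1)"
      using norm[of t] unfolding factor by (simp add: dqcnj_mult dqcnj_diff mult.assoc)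
    then have "u * (r1 * ?x * dqcnj r1) * dqcnj u =
        (t\<^sup>2 + m1 * t + m0) *\<^sub>R ((u * r1) * (dqcnj r1 * dqcnj u))"
      by (simp add: mult.assoc)
    moreover have "u * (r1 * ?x * dqcnj r1) * dqcnj u = (u * r1) * ?x * (dqcnj r1 * dqcnj u)"
      by (simp only: mult.assoc)
    ultimately show ?thesis
      by (simp only: u cnj_u mult_1_left mult_1_right of_real_def)
  qed
  have prod: "h * dqcnj h = of_real m0"
    using right[of 0] by simp
  have "1 - (h + dqcnj h) + h * dqcnj h = of_real (1 + m1 + m0)"
    using right[of 1] by (simp add: algebra_simps)
  then have "h + dqcnj h = 1 + of_real m0 - of_real (1 + m1 + m0)"
    unfolding prod by (simp only: algebra_simps)
  then have sum: "h + dqcnj h = of_real (- m1)"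
    by simp
  have cnj_h: "dqcnj h = of_real (- m1) - h"
    using sum by (simp only: eq_diff_eq add.commute)
  \<comment> \<open>so the conjugate of \<open>h\<close> commutes with \<open>h\<close>\<close>
  have "dqcnj h * h = h * dqcnj h"
    unfolding cnj_h by (simp add: algebra_simps of_real_def)
  then have "(of_real t - dqcnj h) * (of_real t - h) = (of_real t - h) * (of_real t - dqcnj h)" for t
    by (simp add: algebra_simps of_real_def)
  then have "(of_real t - dqcnj h) * (of_real t - h) = of_real (t\<^sup>2 + m1 * t + m0)" for t
    by (simp only: right)
  then show thesis
    using that[of h] factor right prod sum by simp
qed

text \<open>
  The dual quaternions have zero divisors, but degrees still add up since \<open>t - h\<close> is monic.
\<close>

lemma monic_left_factor:
  assumes "\<And>t. dq_poly_eval P t = dq_poly_eval P' t * (of_real t - h)"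
    and "lead_coeff P = 1" and "degree P = Suc n"
  shows "lead_coeff P' = 1" and "degree P' = n"
proof -
  have P: "P = dq_poly_mult P' [:- h, 1:]"
    by (rule dq_poly_eqI) (simp add: assms(1) of_real_def)
  have coeff_P: "coeff P (Suc d) = coeff P' d - coeff P' (Suc d) * h" for d
  proof -
    have "coeff P (Suc d) = (\<Sum>i\<in>{d, Suc d}. coeff P' i * coeff [:- h, 1:] (Suc d - i))"
      unfolding P coeff_dq_poly_mult
      by (rule sum.mono_neutral_right) (auto simp: coeff_pCons split: nat.split)
    then show ?thesis
      by simp
  qed
  have "P' \<noteq> 0"
    using P assms(2) by (auto simp: dq_poly_mult_def)
  have top: "coeff P (Suc (degree P')) = lead_coeff P'"
    by (simp add: coeff_P coeff_eq_0)
  have "degree P = Suc (degree P')"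
  proof (rule antisym)
    show "degree P \<le> Suc (degree P')"
      proof (rule degree_le, intro allI impI)
      fix i
      assume "Suc (degree P') < i"
      then obtain d where "i = Suc d" "degree P' < d"
        by (cases i) auto
      then show "coeff P i = 0"
        by (simp add: coeff_P coeff_eq_0)
    qed
    show "Suc (degree P') \<le> degree P"
      using top \<open>P' \<noteq> 0\<close> by (intro le_degree) simp
  qed
  then show "lead_coeff P' = 1" "degree P' = n"
    using top assms(2,3) by simp_all
qed

lemma irreducible_quadratic_no_root:
  fixes q :: "real poly"
  assumes "irreducible q" "degree q = 2"
  shows "poly q t \<noteq> 0"
proof
  assume "poly q t = 0"
  then obtain s where s: "q = [:- t, 1:] * s"
    by (auto simp: poly_eq_0_iff_dvd)
  then have "s \<noteq> 0"
    using assms(2) by auto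
  then have "degree s = 1"
    using s assms(2) by (simp add: degree_mult_eq del: mult_pCons_left)
  moreover have "[:- t, 1:] dvd 1 \<or> s dvd 1"
    using assms(1) s by (rule irreducibleD)
  ultimately show False
    using is_unit_iff_degree[of s] \<open>s \<noteq> 0\<close> is_unit_iff_degree[of "[:- t, 1:]"] by auto
qed

lemma monic_irreducible_not_dvd_prod:
  fixes q :: "real poly"
  assumes "finite M" "\<And>p. p \<in> insert q M \<Longrightarrow> lead_coeff p = 1 \<and> degree p = 2 \<and> irreducible p"
    and "q \<notin> M"
  shows "\<not> q dvd \<Prod>M"
proof
  assume "q dvd \<Prod>M"
  moreover have "prime_elem q"
    using assms(2)[of q] by (intro field_poly_irreducible_imp_prime) simp
  ultimately obtain p where p: "p \<in> M" "q dvd p"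
    using assms(1) by (auto simp: prod_unfold_prod_mset elim!: prime_elem_dvd_prod_msetE)
  then obtain s where s: "p = q * s" by blast
  have "p \<noteq> 0" "degree p = degree q" "lead_coeff p = 1" "lead_coeff q = 1"
    using assms(2)[of p] assms(2)[of q] p(1) by auto
  then have "degree s = 0"
    using s by (auto simp: degree_mult_eq)
  then obtain c where "s = [:c:]"
    by (rule degree_eq_zeroE)
  then have "p = smult c q"
    using s by simp
  then have "p = q"
    using \<open>p \<noteq> 0\<close> \<open>lead_coeff p = 1\<close> \<open>lead_coeff q = 1\<close> by (cases "c = 0") simp_all
  then show False
    using p(1) assms(3) by simp
qed

lemma monic_quadratic_poly:
  fixes q :: "real poly"
  assumes "lead_coeff q = 1" "degree q = 2"
  obtains m0 m1 where "\<And>t. poly q t = t\<^sup>2 + m1 * t + m0"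
proof
  fix t
  show "poly q t = t\<^sup>2 + coeff q 1 * t + coeff q 0"
    using assms by (simp add: poly_altdef numeral_2_eq_2)
qed

text \<open>
  The inductive step of the factorization. Here \<open>q N\<close> is the norm polynomial of \<open>P\<close>, and
  \<open>q\<close> not dividing \<open>N\<close> expresses that \<open>q\<close> is a simple factor of it.
\<close>

lemma split_right_factor:
  assumes monic: "lead_coeff P = 1" and deg: "degree P = Suc n"
    and q: "lead_coeff q = 1" "degree q = 2" "irreducible q"
    and norm: "\<And>t. dq_poly_eval P t * dqcnj (dq_poly_eval P t) = of_real (poly q t * poly N t)"
    and ndvd: "\<not> q dvd N"
  obtains P' h where "lead_coeff P' = 1" "degree P' = n" "rotation_quaternion h"
    "\<And>t. dq_poly_eval P t = dq_poly_eval P' t * (of_real t - h)"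
    "\<And>t. dq_poly_eval P' t * dqcnj (dq_poly_eval P' t) = of_real (poly N t)"
proof -
  obtain m0 m1 where qt: "\<And>t. poly q t = t\<^sup>2 + m1 * t + m0"
    using monic_quadratic_poly[OF q(1,2)] by blast
  obtain Q r1 r0 where division:
    "\<And>t. dq_poly_eval P t = (t\<^sup>2 + m1 * t + m0) *\<^sub>R dq_poly_eval Q t + (t *\<^sub>R r1 + r0)"
    using dq_poly_division[of P m1 m0] by blast
  have remainder_norm: "(t *\<^sub>R r1 + r0) * dqcnj (t *\<^sub>R r1 + r0) =
      (t\<^sup>2 + m1 * t + m0) *\<^sub>R (r1 * dqcnj r1)" for t
  proof -
    \<comment> \<open>the cofactor of \<open>q\<close> in \<open>R \<cdot> cnj R = P \<cdot> cnj P - q Q \<cdot> cnj P - R \<cdot> q cnj Q\<close>\<close>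
    let ?S = "map_poly of_real N - dq_poly_mult Q (dq_poly_cnj P)
              - dq_poly_mult [:r0, r1:] (dq_poly_cnj Q)"
    have expand: "(t *\<^sub>R r1 + r0) * dqcnj (t *\<^sub>R r1 + r0) =
        t\<^sup>2 *\<^sub>R (r1 * dqcnj r1) + t *\<^sub>R (r1 * dqcnj r0 + r0 * dqcnj r1) + r0 * dqcnj r0" for t
      by (simp add: dqcnj_add dqcnj_scaleR algebra_simps power2_eq_square)
    have multiple: "(t *\<^sub>R r1 + r0) * dqcnj (t *\<^sub>R r1 + r0) =
        (t\<^sup>2 + m1 * t + m0) *\<^sub>R dq_poly_eval ?S t" for t
    proof -
      define c where "c = t\<^sup>2 + m1 * t + m0"
      define x where "x = dq_poly_eval Q t"
      define r where "r = t *\<^sub>R r1 + r0"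
      have P: "dq_poly_eval P t = c *\<^sub>R x + r"
        by (simp add: division c_def x_def r_def)
      have "(c *\<^sub>R x + r) * dqcnj (c *\<^sub>R x + r) = c *\<^sub>R of_real (poly N t)"
        using norm[of t] by (simp add: P qt flip: c_def) (simp add: of_real_def)
      then have "r * dqcnj r =
          c *\<^sub>R (of_real (poly N t) - x * dqcnj (c *\<^sub>R x + r) - r * dqcnj x)"
        by (simp add: dqcnj_add dqcnj_scaleR algebra_simps)
      then show ?thesis
        by (simp add: P add.commute[of r0] flip: c_def x_def r_def)
    qed
    show ?thesis
      unfolding expand
    proof (rule quadratic_multiple_of_quadratic)
      show "t\<^sup>2 *\<^sub>R (r1 * dqcnj r1) + t *\<^sub>R (r1 * dqcnj r0 + r0 * dqcnj r1) + r0 * dqcnj r0 =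
          (t\<^sup>2 + m1 * t + m0) *\<^sub>R dq_poly_eval ?S t" for t
        using multiple[of t] unfolding expand .
    qed
  qed
  have "primal r1 \<noteq> 0"
  proof
    assume "primal r1 = 0"
    have "primal (t *\<^sub>R r1 + r0) = 0" for t
    proof (rule primal_eq_0_if_norm_eq_0)
      show "primal ((t *\<^sub>R r1 + r0) * dqcnj (t *\<^sub>R r1 + r0)) = 0"
        unfolding remainder_norm using \<open>primal r1 = 0\<close> by simp
    qed
    then have primal_P: "primal (dq_poly_eval P t) = poly q t *\<^sub>R primal (dq_poly_eval Q t)" for t
      using division[of t] qt[of t] by simp
    \<comment> \<open>the real polynomial giving the norm of the primal part of \<open>Q\<close>; it yields \<open>q N = q\<^sup>2 T\<close>\<close>
    define T where "T = map_poly (\<lambda>x. qre (primal x)) (dq_poly_mult Q (dq_poly_cnj Q))"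
    have T: "poly T t = qre (primal (dq_poly_eval Q t * dqcnj (dq_poly_eval Q t)))" for t
      unfolding T_def by (subst poly_map_poly_linear) simp_all
    have "poly q t * poly N t = poly q t * (poly q t * poly T t)" for t
    proof -
      have "poly q t * poly N t = qre (primal (dq_poly_eval P t * dqcnj (dq_poly_eval P t)))"
        by (simp only: norm primal_of_real qre_of_real)
      also have "\<dots> = poly q t * (poly q t * poly T t)"
        by (simp add: T primal_P algebra_simps)
      finally show ?thesis .
    qed
    then have "poly N t = poly q t * poly T t" for t
      using irreducible_quadratic_no_root[OF q(3,2)] mult_left_cancel by blast
    then have "N = q * T"
      by (simp add: fun_eq_iff flip: poly_eq_poly_eq_iff)
    then show False
      using ndvd by simp
  qed
  then obtain h where h:
    "\<And>t. t *\<^sub>R r1 + r0 = r1 * (of_real t - h)"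
    "\<And>t. (of_real t - h) * (of_real t - dqcnj h) = of_real (t\<^sup>2 + m1 * t + m0)"
    "\<And>t. (of_real t - dqcnj h) * (of_real t - h) = of_real (t\<^sup>2 + m1 * t + m0)"
    "h * dqcnj h = of_real m0" "h + dqcnj h = of_real (- m1)"
    using linear_remainder_root[OF _ remainder_norm] by blast
  have "primal h \<notin> \<real>"
  proof
    assume "primal h \<in> \<real>"
    then obtain a where a: "primal h = of_real a"
      by (rule Reals_cases)
    \<comment> \<open>a real primal part would be a real root of \<open>q\<close>\<close>
    have "primal ((of_real a - h) * (of_real a - dqcnj h)) = 0"
      by (simp add: a)
    then have "of_real (poly q a) = (0::quat)"
      unfolding h(2) qt primal_of_real .
    then show False
      using irreducible_quadratic_no_root[OF q(3,2), of a] by simp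
  qed
  then have rot: "rotation_quaternion h"
    using h(4,5) by (auto simp: rotation_quaternion_def)
  \<comment> \<open>\<open>t - h\<close> is a right factor of \<open>q = (t - cnj h)(t - h)\<close> and of \<open>R = r1 (t - h)\<close>\<close>
  define P' where "P' = dq_poly_mult Q [:- dqcnj h, 1:] + [:r1:]"
  have factor: "dq_poly_eval P t = dq_poly_eval P' t * (of_real t - h)" for t
  proof -
    have "dq_poly_eval P' t = dq_poly_eval Q t * (of_real t - dqcnj h) + r1"
      by (simp add: P'_def of_real_def)
    then have "dq_poly_eval P' t * (of_real t - h) =
        dq_poly_eval Q t * ((of_real t - dqcnj h) * (of_real t - h)) + r1 * (of_real t - h)"
      by (simp only: distrib_right mult.assoc)
    also have "\<dots> = dq_poly_eval P t"
      unfolding h(3) division h(1)[of t, symmetric]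
      by (simp only: of_real_def mult_scaleR_right mult_1_right)
    finally show ?thesis by simp
  qed
  have norm': "dq_poly_eval P' t * dqcnj (dq_poly_eval P' t) = of_real (poly N t)" for t
  proof -
    let ?x = "dq_poly_eval P' t"
    have "of_real (poly q t * poly N t) =
        ?x * ((of_real t - h) * (of_real t - dqcnj h)) * dqcnj ?x"
      unfolding norm[symmetric] factor by (simp only: dqcnj_mult dqcnj_diff dqcnj_of_real mult.assoc)
    then have "poly q t *\<^sub>R of_real (poly N t) = poly q t *\<^sub>R (?x * dqcnj ?x)"
      unfolding h(2) qt[symmetric] by (simp add: of_real_def)
    then show ?thesis
      using irreducible_quadratic_no_root[OF q(3,2), of t] by simp
  qed
  show thesis
    by (rule that[OF monic_left_factor[OF factor monic deg] rot factor norm'])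
qed

section \<open>Factorization of generic motion polynomials\<close>

lemma generic_factorization:
  assumes "lead_coeff P = 1" "degree P = n" "finite M" "card M = n"
    and "\<And>q. q \<in> M \<Longrightarrow> lead_coeff q = 1 \<and> degree q = 2 \<and> irreducible q"
    and "\<And>t. dq_poly_eval P t * dqcnj (dq_poly_eval P t) = of_real (poly (\<Prod>M) t)"
  shows "\<exists>hs. length hs = n \<and> (\<forall>h\<in>set hs. rotation_quaternion h) \<and>
           (\<forall>t. dq_poly_eval P t = prod_list (map (\<lambda>h. of_real t - h) hs))"
  using assms
proof (induction n arbitrary: P M)
  case 0
  then obtain a where "P = [:a:]"
    by (auto elim: degree_eq_zeroE)
  with 0 show ?case by simp
next
  case (Suc n)
  from \<open>card M = Suc n\<close> obtain q M' where M: "M = insert q M'" "q \<notin> M'" "card M' = n"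
    by (auto simp: card_Suc_eq)
  have "finite M'"
    using Suc.prems(3) M by simp
  have q: "lead_coeff q = 1" "degree q = 2" "irreducible q"
    using Suc.prems(5)[of q] M(1) by blast+
  have "\<not> q dvd \<Prod>M'"
    using monic_irreducible_not_dvd_prod[of M' q] \<open>finite M'\<close> M Suc.prems(5) by blast
  moreover have "dq_poly_eval P t * dqcnj (dq_poly_eval P t) = of_real (poly q t * poly (\<Prod>M') t)" for t
    using Suc.prems(6) M \<open>finite M'\<close> by simp
  ultimately obtain P' h where P': "lead_coeff P' = 1" "degree P' = n" "rotation_quaternion h"
    "\<And>t. dq_poly_eval P t = dq_poly_eval P' t * (of_real t - h)"
    "\<And>t. dq_poly_eval P' t * dqcnj (dq_poly_eval P' t) = of_real (poly (\<Prod>M') t)"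
    using split_right_factor[OF Suc.prems(1,2) q] by blast
  obtain hs where "length hs = n" "\<forall>h\<in>set hs. rotation_quaternion h"
    "\<forall>t. dq_poly_eval P' t = prod_list (map (\<lambda>h. of_real t - h) hs)"
    using Suc.IH[OF P'(1,2) \<open>finite M'\<close> M(3) _ P'(5)] Suc.prems(5) M(1) by blast
  then show ?case
    using P'(3,4) by (intro exI[of _ "hs @ [h]"]) auto
qed

section \<open>Realization by a linkage\<close>

theorem corollary9:
  fixes n :: nat and C :: "point set"
  assumes "n > 0"
    and "generic_rational_curve n C"
  shows "\<exists>k\<le>n. \<exists>(g :: nat \<Rightarrow> dquat) (m :: nat \<Rightarrow> nat) (R1 :: nat \<Rightarrow> real poly) (R2 :: nat \<Rightarrow> real poly).
           (\<forall>j\<in>{1..k}. rotation_quaternion (g j) \<and> m j > 0 \<and>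
                        rotation_parametrization (m j) (R1 j) (R2 j)) \<and>
           (\<Sum>j=1..k. m j) = n \<and>
           C = range (last_link_position k g R1 R2)"
proof -
  obtain P where P: "generic_motion_polynomial P" "degree P = n" "C = range (assoc_map P)"
    using assms(2) by (auto simp: generic_rational_curve_def)
  then obtain M where M: "finite M" "card M = n"
    "\<And>q. q \<in> M \<Longrightarrow> lead_coeff q = 1 \<and> degree q = 2 \<and> irreducible q"
    "dq_poly_mult P (dq_poly_cnj P) = map_poly of_real (\<Prod>M)"
    by (auto simp: generic_motion_polynomial_def)
  have "lead_coeff P = 1"
    using P(1) by (simp add: generic_motion_polynomial_def motion_polynomial_def)
  moreover have "dq_poly_eval P t * dqcnj (dq_poly_eval P t) = of_real (poly (\<Prod>M) t)" for t
    using arg_cong[OF M(4), of "\<lambda>A. dq_poly_eval A t"]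
    by (simp only: dq_poly_eval_mult dq_poly_eval_cnj dq_poly_eval_of_real)
  ultimately obtain hs where hs: "length hs = n" "\<forall>h\<in>set hs. rotation_quaternion h"
    "\<And>t. dq_poly_eval P t = prod_list (map (\<lambda>h. of_real t - h) hs)"
    using generic_factorization[OF _ P(2) M(1-3)] by blast
  define g where "g j = hs ! (j - 1)" for j
  define R1 :: "nat \<Rightarrow> real poly" where "R1 j = [:0, 1:]" for j
  define R2 :: "nat \<Rightarrow> real poly" where "R2 j = 1" for j
  have g_hs: "map g [1..<Suc n] = hs"
    using hs(1) by (intro nth_equalityI) (simp_all add: g_def nth_upt del: upt_Suc)
  have "last_link_position n g R1 R2 \<tau> = assoc_map P \<tau>" for \<tau>
  proof (cases \<tau>)
    case (Fin t)
    have "map (\<lambda>j. joint_value (g j) (R1 j) (R2 j) \<tau>) [1..<Suc n] =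
        map (\<lambda>h. of_real t - h) (map g [1..<Suc n])"
      by (simp add: Fin joint_value_def R1_def R2_def del: upt_Suc)
    then show ?thesis
      unfolding last_link_position_def assoc_map_def hs(3) g_hs by (simp add: Fin)
  next
    case Infty
    have "prod_list (map (\<lambda>j. 1::dquat) xs) = 1" for xs :: "nat list"
      by (induction xs) simp_all
    then show ?thesis
      by (simp only: last_link_position_def assoc_map_def joint_value_def Infty rp1.case)
  qed
  then have "C = range (last_link_position n g R1 R2)"
    using P(3) by simp
  moreover have "rotation_quaternion (g j)" if "j \<in> {1..n}" for j
    using that hs(1,2) by (auto simp: g_def)
  moreover have "rotation_parametrization 1 (R1 j) (R2 j)" for j
    by (simp add: rotation_parametrization_def R1_def R2_def)
  \<comment> \<open>every joint has degree one, so the degrees add up to \<open>n\<close>\<close>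
  ultimately show ?thesis
    by (intro exI[of _ n] exI[of _ g] exI[of _ "\<lambda>_. 1"] exI[of _ R1] exI[of _ R2] conjI ballI)
      simp_all
qed

end
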